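(* Let $(Q;\cdot)$ be a linear isotope of a group. If $(Q;\cdot)$ is commutative, left symmetric, right symmetric or totally symmetric, then $(Q;\cdot)$ is a medial quasigroup.
   Context: A linear isotope of a group is a quasigroup $(Q;\cdot)$ for which there exist a group $(Q;+)$ (written additively, not necessarily commutative), automorphisms $\varphi,\psi$ of $(Q;+)$ and an element $c\in Q$ such that $x\cdot y=\varphi x+c+\psi y$ for all $x,y\in Q$. A quasigroup is commutative if it satisfies $xy=yx$; left symmetric if $x\cdot xy=y$; right symmetric if $xy\cdot y=x$; totally symmetric if $xy=yx$ and $xy\cdot y=x$; medial if $xy\cdot uv=xu\cdot yv$. *)

theory Defs
  imports "HOL-Algebra.Group"
begin

definition quasigroup :: "'a set \<Rightarrow> ('a \<Rightarrow> 'a \<Rightarrow> 'a) \<Rightarrow> bool" where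
  "quasigroup Q f \<longleftrightarrow>
     (\<forall>x\<in>Q. \<forall>y\<in>Q. f x y \<in> Q) \<and>
     (\<forall>a\<in>Q. \<forall>b\<in>Q. \<exists>!x. x \<in> Q \<and> f a x = b) \<and>
     (\<forall>a\<in>Q. \<forall>b\<in>Q. \<exists>!y. y \<in> Q \<and> f y a = b)"

(* The group (Q;+) is a HOL-Algebra group, hence written multiplicatively here;
   its automorphisms are the elements of iso G G, constrained only on the carrier. *)
definition linear_group_isotope :: "'a set \<Rightarrow> ('a \<Rightarrow> 'a \<Rightarrow> 'a) \<Rightarrow> bool" where
  "linear_group_isotope Q f \<longleftrightarrow>
     quasigroup Q f \<and>
     (\<exists>(G :: 'a monoid) \<phi> \<psi> c.
        group G \<and> carrier G = Q \<and> \<phi> \<in> iso G G \<and> \<psi> \<in> iso G G \<and> c \<in> Q \<and>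
        (\<forall>x\<in>Q. \<forall>y\<in>Q. f x y = \<phi> x \<otimes>\<^bsub>G\<^esub> c \<otimes>\<^bsub>G\<^esub> \<psi> y))"

definition commutative_op :: "'a set \<Rightarrow> ('a \<Rightarrow> 'a \<Rightarrow> 'a) \<Rightarrow> bool" where
  "commutative_op Q f \<longleftrightarrow> (\<forall>x\<in>Q. \<forall>y\<in>Q. f x y = f y x)"

definition left_symmetric :: "'a set \<Rightarrow> ('a \<Rightarrow> 'a \<Rightarrow> 'a) \<Rightarrow> bool" where
  "left_symmetric Q f \<longleftrightarrow> (\<forall>x\<in>Q. \<forall>y\<in>Q. f x (f x y) = y)"

definition right_symmetric :: "'a set \<Rightarrow> ('a \<Rightarrow> 'a \<Rightarrow> 'a) \<Rightarrow> bool" where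
  "right_symmetric Q f \<longleftrightarrow> (\<forall>x\<in>Q. \<forall>y\<in>Q. f (f x y) y = x)"

definition totally_symmetric :: "'a set \<Rightarrow> ('a \<Rightarrow> 'a \<Rightarrow> 'a) \<Rightarrow> bool" where
  "totally_symmetric Q f \<longleftrightarrow> (\<forall>x\<in>Q. \<forall>y\<in>Q. f x y = f y x \<and> f (f x y) y = x)"

definition medial :: "'a set \<Rightarrow> ('a \<Rightarrow> 'a \<Rightarrow> 'a) \<Rightarrow> bool" where
  "medial Q f \<longleftrightarrow>
     (\<forall>x\<in>Q. \<forall>y\<in>Q. \<forall>u\<in>Q. \<forall>v\<in>Q. f (f x y) (f u v) = f (f x u) (f y v))"

end

theory Submission
  imports Defs
begin

text \<open>
  Write the isotope as \<open>x \<cdot> y = \<phi> x + c + \<psi> y\<close>. It is medial as soon as the group is abelian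
  and \<open>\<phi>\<close>, \<open>\<psi>\<close> commute. Specialising variables to the neutral element, commutativity forces the
  group to be abelian with \<open>\<phi> = \<psi>\<close>. Left symmetry makes \<open>\<psi>\<close> the map \<open>z \<mapsto> - c - z + c\<close>, and an
  endomorphism that is an inversion followed by a conjugation exists only on an abelian group,
  where it commutes with every endomorphism. Right symmetry does the same for \<open>\<phi>\<close>, and total
  symmetry contains commutativity.
\<close>

text \<open>After expansion, one side of the medial law contains \<open>\<phi> (\<psi> y)\<close>
  and \<open>\<psi> (\<phi> u)\<close> where the other has \<open>\<phi> (\<psi> u)\<close> and
  \<open>\<psi> (\<phi> y)\<close>. The commuting maps identify these factors, and the abelian group
  reorders them.\<close>

lemma medial_if_commuting_endomorphisms:
  assumes "comm_group G" and \<phi>: "\<phi> \<in> hom G G" and \<psi>: "\<psi> \<in> hom G G" and c: "c \<in> carrier G"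
    and f: "\<And>x y. x \<in> carrier G \<Longrightarrow> y \<in> carrier G \<Longrightarrow> f x y = \<phi> x \<otimes>\<^bsub>G\<^esub> c \<otimes>\<^bsub>G\<^esub> \<psi> y"
    and commute: "\<And>x. x \<in> carrier G \<Longrightarrow> \<phi> (\<psi> x) = \<psi> (\<phi> x)"
  shows "medial (carrier G) f"
proof -
  interpret comm_group G by fact
  note [simp] = hom_in_carrier[OF \<phi>] hom_in_carrier[OF \<psi>] hom_mult[OF \<phi>] hom_mult[OF \<psi>] c
  show ?thesis
    unfolding medial_def by (simp add: f commute m_ac)
qed

text \<open>Inversion reverses products and conjugation by \<open>a\<close> preserves them, so
  \<open>\<theta>\<close> reverses products; as a homomorphism it also preserves them. Hence any two
  elements commute, and the conjugation is then trivial.\<close>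

lemma (in group) inverting_endomorphism:
  assumes hom: "\<theta> \<in> hom G G" and a: "a \<in> carrier G"
    and \<theta>: "\<And>z. z \<in> carrier G \<Longrightarrow> \<theta> z = inv a \<otimes> inv z \<otimes> a"
  shows "comm_group G" and "\<And>z. z \<in> carrier G \<Longrightarrow> \<theta> z = inv z"
proof -
  show comm: "comm_group G"
  proof (rule group_comm_groupI)
    fix x y assume [simp]: "x \<in> carrier G" "y \<in> carrier G"
    note [simp] = a
    have cancel: "a \<otimes> (inv a \<otimes> w) = w" if "w \<in> carrier G" for w
      using that by (simp flip: m_assoc)
    have "inv a \<otimes> (inv (x \<otimes> y) \<otimes> a) = \<theta> (x \<otimes> y)"
      by (simp add: \<theta> m_assoc)
    also have "\<dots> = inv a \<otimes> (inv (y \<otimes> x) \<otimes> a)"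
      unfolding hom_mult[OF hom \<open>x \<in> carrier G\<close> \<open>y \<in> carrier G\<close>]
      by (simp add: \<theta> m_assoc inv_mult_group cancel)
    finally have "inv (x \<otimes> y) = inv (y \<otimes> x)"
      by simp
    then show "x \<otimes> y = y \<otimes> x"
      by (simp add: inv_inj inj_on_eq_iff[OF inv_inj])
  qed
  interpret comm_group G by (rule comm)
  fix z assume "z \<in> carrier G"
  then show "\<theta> z = inv z"
    using a by (simp add: \<theta> m_comm[of "inv a"] m_assoc)
qed

lemma iso_imageE:
  assumes "h \<in> iso G G" "y \<in> carrier G"
  obtains x where "x \<in> carrier G" "y = h x"
  using assms by (auto simp: iso_def bij_betw_def)

lemma hom_inv_commute:
  assumes "group G" "h \<in> hom G G" "x \<in> carrier G"
  shows "h (inv\<^bsub>G\<^esub> x) = inv\<^bsub>G\<^esub> (h x)"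
  using assms by (meson group_hom.hom_inv group_hom.intro group_hom_axioms.intro)

theorem corollary10:
  fixes Q :: "'a set" and f :: "'a \<Rightarrow> 'a \<Rightarrow> 'a"
  assumes "linear_group_isotope Q f"
    and "commutative_op Q f \<or> left_symmetric Q f \<or> right_symmetric Q f \<or> totally_symmetric Q f"
  shows "quasigroup Q f \<and> medial Q f"
proof
  show "quasigroup Q f"
    using assms(1) by (simp add: linear_group_isotope_def)
  obtain G :: "'a monoid" and \<phi> \<psi> c where G: "group G" and Q: "Q = carrier G"
    and iso: "\<phi> \<in> iso G G" "\<psi> \<in> iso G G" and c: "c \<in> carrier G"
    and f: "\<And>x y. x \<in> carrier G \<Longrightarrow> y \<in> carrier G \<Longrightarrow> f x y = \<phi> x \<otimes>\<^bsub>G\<^esub> c \<otimes>\<^bsub>G\<^esub> \<psi> y"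
    using assms(1) unfolding linear_group_isotope_def by blast
  interpret group G by (rule G)
  have \<phi>: "\<phi> \<in> hom G G" and \<psi>: "\<psi> \<in> hom G G"
    using iso by (simp_all add: iso_def)
  note [simp] = hom_in_carrier[OF \<phi>] hom_in_carrier[OF \<psi>] hom_mult[OF \<phi>] hom_mult[OF \<psi>]
    hom_one[OF \<phi> G G] hom_one[OF \<psi> G G] c
  note medialI = medial_if_commuting_endomorphisms[OF _ \<phi> \<psi> c f]
  consider (comm) "commutative_op Q f" | (left) "left_symmetric Q f" | (right) "right_symmetric Q f"
    using assms(2) by (auto simp: commutative_op_def totally_symmetric_def)
  then show "medial Q f"
  proof cases
    case comm
    then have eq: "\<phi> x \<otimes>\<^bsub>G\<^esub> c \<otimes>\<^bsub>G\<^esub> \<psi> y = \<phi> y \<otimes>\<^bsub>G\<^esub> c \<otimes>\<^bsub>G\<^esub> \<psi> x"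
      if "x \<in> carrier G" "y \<in> carrier G" for x y
      using that by (metis Q commutative_op_def f)
    \<comment> \<open>With \<open>y\<close> neutral, \<open>eq\<close> says that \<open>c\<close>
      conjugates \<open>\<psi>\<close> into \<open>\<phi>\<close>.\<close>
    have conj: "\<phi> x \<otimes>\<^bsub>G\<^esub> c = c \<otimes>\<^bsub>G\<^esub> \<psi> x" if "x \<in> carrier G" for x
      using eq[of x "\<one>\<^bsub>G\<^esub>"] that by simp
    have "comm_group G"
    proof (rule group_comm_groupI)
      fix x y assume "x \<in> carrier G" "y \<in> carrier G"
      \<comment> \<open>Since \<open>\<phi>\<close> is onto, it suffices to commute values of
        \<open>\<phi>\<close>; \<open>conj\<close> moves \<open>c\<close> past the second factor,
        which turns the product into one that \<open>eq\<close> can swap.\<close>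
      then obtain x' y' where [simp]: "x' \<in> carrier G" "y' \<in> carrier G"
        and xy: "x = \<phi> x'" "y = \<phi> y'"
        using iso(1) by (metis iso_imageE)
      have "x \<otimes>\<^bsub>G\<^esub> y \<otimes>\<^bsub>G\<^esub> c = \<phi> x' \<otimes>\<^bsub>G\<^esub> c \<otimes>\<^bsub>G\<^esub> \<psi> y'"
        by (simp add: xy m_assoc flip: conj)
      also have "\<dots> = \<phi> y' \<otimes>\<^bsub>G\<^esub> c \<otimes>\<^bsub>G\<^esub> \<psi> x'"
        by (rule eq) simp_all
      also have "\<dots> = y \<otimes>\<^bsub>G\<^esub> x \<otimes>\<^bsub>G\<^esub> c"
        by (simp add: xy m_assoc flip: conj)
      finally have "x \<otimes>\<^bsub>G\<^esub> y \<otimes>\<^bsub>G\<^esub> c = y \<otimes>\<^bsub>G\<^esub> x \<otimes>\<^bsub>G\<^esub> c" .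
      then show "x \<otimes>\<^bsub>G\<^esub> y = y \<otimes>\<^bsub>G\<^esub> x"
        by (simp add: xy)
    qed
    then interpret comm_group G .
    \<comment> \<open>In the abelian group \<open>c\<close> cancels from \<open>conj\<close>, so the
      two maps coincide and trivially commute.\<close>
    have "\<phi> x = \<psi> x" if "x \<in> carrier G" for x
      using conj[OF that] that by (simp add: m_comm[of "\<phi> x"])
    then show ?thesis
      unfolding Q by (intro medialI) (simp_all add: comm_group_axioms)
  next
    case left
    then have eq: "\<phi> x \<otimes>\<^bsub>G\<^esub> c \<otimes>\<^bsub>G\<^esub> \<psi> (\<phi> x \<otimes>\<^bsub>G\<^esub> c \<otimes>\<^bsub>G\<^esub> \<psi> y) = y"
      if "x \<in> carrier G" "y \<in> carrier G" for x y
      using that by (simp add: Q left_symmetric_def f)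
    have "c \<otimes>\<^bsub>G\<^esub> \<psi> c = \<one>\<^bsub>G\<^esub>"
      using eq[of "\<one>\<^bsub>G\<^esub>" "\<one>\<^bsub>G\<^esub>"] by simp
    then have \<psi>c: "\<psi> c = inv\<^bsub>G\<^esub> c"
      by (metis inv_equality inv_comm c hom_in_carrier[OF \<psi>])
    have inverting: "\<psi> z = inv\<^bsub>G\<^esub> c \<otimes>\<^bsub>G\<^esub> inv\<^bsub>G\<^esub> z \<otimes>\<^bsub>G\<^esub> c" if z: "z \<in> carrier G" for z
    proof -
      obtain x where [simp]: "x \<in> carrier G" and zx: "z = \<phi> x"
        using iso_imageE[OF iso(1) z] .
      \<comment> \<open>This is \<open>eq\<close> at \<open>y\<close> neutral, with
        \<open>\<psi> (z \<otimes> c)\<close> split and \<open>\<psi> c\<close> replaced by the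
        inverse of \<open>c\<close>. Surjectivity of \<open>\<phi>\<close> makes \<open>z\<close>
        arbitrary.\<close>
      have "(z \<otimes>\<^bsub>G\<^esub> c) \<otimes>\<^bsub>G\<^esub> (\<psi> z \<otimes>\<^bsub>G\<^esub> inv\<^bsub>G\<^esub> c) = \<one>\<^bsub>G\<^esub>"
        using eq[of x "\<one>\<^bsub>G\<^esub>"] by (simp add: zx \<psi>c m_assoc)
      then have "\<psi> z \<otimes>\<^bsub>G\<^esub> inv\<^bsub>G\<^esub> c = inv\<^bsub>G\<^esub> (z \<otimes>\<^bsub>G\<^esub> c)"
        using z by (metis inv_equality inv_comm m_closed inv_closed c hom_in_carrier[OF \<psi>])
      then show ?thesis
        using z by (metis inv_mult_group inv_solve_right' m_closed inv_closed c inv_inv hom_in_carrier[OF \<psi>])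
    qed
    note abelian = inverting_endomorphism[OF \<psi> c inverting]
    \<comment> \<open>Now \<open>\<psi>\<close> is plain inversion, which the homomorphism
      \<open>\<phi>\<close> respects.\<close>
    show ?thesis
      unfolding Q by (rule medialI) (simp_all add: abelian hom_inv_commute[OF G \<phi>])
  next
    case right
    then have eq: "\<phi> (\<phi> x \<otimes>\<^bsub>G\<^esub> c \<otimes>\<^bsub>G\<^esub> \<psi> y) \<otimes>\<^bsub>G\<^esub> c \<otimes>\<^bsub>G\<^esub> \<psi> y = x"
      if "x \<in> carrier G" "y \<in> carrier G" for x y
      using that by (simp add: Q right_symmetric_def f)
    have "\<phi> c \<otimes>\<^bsub>G\<^esub> c = \<one>\<^bsub>G\<^esub>"
      using eq[of "\<one>\<^bsub>G\<^esub>" "\<one>\<^bsub>G\<^esub>"] by simp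
    then have \<phi>c: "\<phi> c = inv\<^bsub>G\<^esub> c"
      by (metis inv_equality c hom_in_carrier[OF \<phi>])
    \<comment> \<open>Mirror image of the left case: the conjugating element is now the inverse of
      \<open>c\<close>, hence the double inverse.\<close>
    have inverting: "\<phi> z = inv\<^bsub>G\<^esub> (inv\<^bsub>G\<^esub> c) \<otimes>\<^bsub>G\<^esub> inv\<^bsub>G\<^esub> z \<otimes>\<^bsub>G\<^esub> inv\<^bsub>G\<^esub> c" if z: "z \<in> carrier G" for z
    proof -
      obtain y where [simp]: "y \<in> carrier G" and zy: "z = \<psi> y"
        using iso_imageE[OF iso(2) z] .
      \<comment> \<open>Here \<open>x\<close> is neutral, and \<open>z\<close> is arbitrary because
        \<open>\<psi>\<close> is onto.\<close>
      have "(inv\<^bsub>G\<^esub> c \<otimes>\<^bsub>G\<^esub> \<phi> z) \<otimes>\<^bsub>G\<^esub> (c \<otimes>\<^bsub>G\<^esub> z) = \<one>\<^bsub>G\<^esub>"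
        using eq[of "\<one>\<^bsub>G\<^esub>" y] by (simp add: zy \<phi>c m_assoc)
      then have "inv\<^bsub>G\<^esub> c \<otimes>\<^bsub>G\<^esub> \<phi> z = inv\<^bsub>G\<^esub> (c \<otimes>\<^bsub>G\<^esub> z)"
        using z by (metis inv_equality m_closed inv_closed c hom_in_carrier[OF \<phi>])
      then have "\<phi> z = c \<otimes>\<^bsub>G\<^esub> inv\<^bsub>G\<^esub> (c \<otimes>\<^bsub>G\<^esub> z)"
        using z by (metis inv_solve_left' m_closed inv_closed c inv_inv hom_in_carrier[OF \<phi>])
      then show ?thesis
        using z by (simp add: inv_mult_group m_assoc)
    qed
    note abelian = inverting_endomorphism[OF \<phi> inv_closed[OF c] inverting]
    show ?thesis
      unfolding Q by (rule medialI) (simp_all add: abelian hom_inv_commute[OF G \<psi>])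
  qed
qed

end
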